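(* Let $X$ be a $T_1$ regular topological space. If $X$ is strongly monotonically normal, then $X$ is an $s$-$m_2$-space.
   Context: A space $X$ is strongly monotonically normal if there is a function $G$ which assigns to each ordered pair $(H,K)$ of disjoint closed subsets of $X$ an open subset $G(H,K)\subset X$ such that: (1) $H\subset G(H,K)\subset\overline{G(H,K)}\subset X\setminus K$; (2) $G(H,K)\subset G(H',K')$ whenever $H',K'$ are disjoint closed subsets with $H\subset H'$ and $K\supset K'$; (3) $G(H,K)\cap G(K,H)=\emptyset$; (4) if $H'$ is closed in $X$ and $H'\subset G(H,K)$, then $G(H',K)\subset G(H,K)$. A family $\mathcal{P}$ of subsets of $X$ is closure-preserving if for every $\mathcal{P}'\subset\mathcal{P}$ we have $\overline{\bigcup\mathcal{P}'}=\bigcup\{\overline{P}: P\in\mathcal{P}'\}$. A family $\mathcal{A}$ of (not necessarily open) subsets of $X$ is a quasi-base of $X$ at a set $A\subset X$ if $A=\bigcap\mathcal{A}$ and for every neighborhood $U$ of $A$ there is $V\in\mathcal{A}$ with $A\subset\mathrm{int}(V)\subset V\subset U$. $X$ is $s$-$m_2$ at a closed set $F$ if $X$ has a closure-preserving quasi-base at $F$. $X$ is an $s$-$m_2$-space if it is $s$-$m_2$ at every closed subset. *)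

theory Defs
  imports "HOL-Analysis.Analysis"
begin

text \<open>The operator is a total function on pairs of sets, but it is constrained, and used, only at
  ordered pairs of disjoint closed subsets of \<open>X\<close>. In the last clause the pair \<open>(H', K)\<close> is
  automatically disjoint, because the first clause makes \<open>G H K\<close> disjoint from \<open>K\<close>.\<close>

definition disjoint_closed_pair :: "'a topology \<Rightarrow> 'a set \<Rightarrow> 'a set \<Rightarrow> bool" where
  "disjoint_closed_pair X H K \<longleftrightarrow> closedin X H \<and> closedin X K \<and> H \<inter> K = {}"

definition strong_monotone_normality_operator ::
    "'a topology \<Rightarrow> ('a set \<Rightarrow> 'a set \<Rightarrow> 'a set) \<Rightarrow> bool" where
  "strong_monotone_normality_operator X G \<longleftrightarrow>
     (\<forall>H K. disjoint_closed_pair X H K \<longrightarrow> openin X (G H K)) \<and>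
     (\<forall>H K. disjoint_closed_pair X H K \<longrightarrow>
        H \<subseteq> G H K \<and> G H K \<subseteq> X closure_of (G H K) \<and>
        X closure_of (G H K) \<subseteq> topspace X - K) \<and>
     (\<forall>H K H' K'. disjoint_closed_pair X H K \<longrightarrow> disjoint_closed_pair X H' K' \<longrightarrow>
        H \<subseteq> H' \<longrightarrow> K' \<subseteq> K \<longrightarrow> G H K \<subseteq> G H' K') \<and>
     (\<forall>H K. disjoint_closed_pair X H K \<longrightarrow> G H K \<inter> G K H = {}) \<and>
     (\<forall>H K H'. disjoint_closed_pair X H K \<longrightarrow> closedin X H' \<longrightarrow> H' \<subseteq> G H K \<longrightarrow>
        G H' K \<subseteq> G H K)"

definition strongly_monotonically_normal :: "'a topology \<Rightarrow> bool" where
  "strongly_monotonically_normal X \<longleftrightarrow> (\<exists>G. strong_monotone_normality_operator X G)"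

definition closure_preserving :: "'a topology \<Rightarrow> 'a set set \<Rightarrow> bool" where
  "closure_preserving X \<P> \<longleftrightarrow>
     (\<forall>\<P>' \<subseteq> \<P>. X closure_of (\<Union>\<P>') = (\<Union>P\<in>\<P>'. X closure_of P))"

text \<open>Neighborhoods of a set need not be open.\<close>

definition neighborhood_of_set :: "'a topology \<Rightarrow> 'a set \<Rightarrow> 'a set \<Rightarrow> bool" where
  "neighborhood_of_set X A U \<longleftrightarrow> U \<subseteq> topspace X \<and> A \<subseteq> X interior_of U"

text \<open>A quasi-base is never empty (take \<open>U = topspace X\<close> in the last clause), so \<open>\<Inter>\<A>\<close> is
  the intersection taken within \<open>X\<close>.\<close>

definition quasi_base_at :: "'a topology \<Rightarrow> 'a set \<Rightarrow> 'a set set \<Rightarrow> bool" where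
  "quasi_base_at X A \<A> \<longleftrightarrow>
     A \<subseteq> topspace X \<and> (\<forall>V\<in>\<A>. V \<subseteq> topspace X) \<and> A = \<Inter>\<A> \<and>
     (\<forall>U. neighborhood_of_set X A U \<longrightarrow>
        (\<exists>V\<in>\<A>. A \<subseteq> X interior_of V \<and> X interior_of V \<subseteq> V \<and> V \<subseteq> U))"

definition s_m2_at :: "'a topology \<Rightarrow> 'a set \<Rightarrow> bool" where
  "s_m2_at X F \<longleftrightarrow> (\<exists>\<A>. quasi_base_at X F \<A> \<and> closure_preserving X \<A>)"

definition s_m2_space :: "'a topology \<Rightarrow> bool" where
  "s_m2_space X \<longleftrightarrow> (\<forall>F. closedin X F \<longrightarrow> s_m2_at X F)"

end

theory Submission
  imports Defs
begin

text \<open>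
  Fix a closed set \<open>F\<close> and a strong monotone normality operator \<open>G\<close>. The quasi-base at \<open>F\<close> consists
  of the complements of the sets \<open>G K F\<close>, where \<open>K\<close> runs over the closed sets disjoint from \<open>F\<close>.

  It is a quasi-base because \<open>G K F\<close> misses the open neighborhood \<open>G F K\<close> of \<open>F\<close> and contains \<open>K\<close>:
  given an open \<open>U \<supseteq> F\<close>, take for \<open>K\<close> the complement of \<open>U\<close>; given a point \<open>x\<close> outside \<open>F\<close>, take
  \<open>K = {x}\<close>, which is closed in a \<open>T\<^sub>1\<close> space
  (\<open>quasi_base_at_complements_G\<close>).

  The members are closed, so closure preservation says that any intersection of sets \<open>G K F\<close> is
  open. This is where the fourth condition on \<open>G\<close> enters: the sets \<open>G K F\<close> are hereditary in the
  sense that \<open>x \<in> G K F\<close> implies \<open>G {x} F \<subseteq> G K F\<close>. The same open set \<open>G {x} F\<close> thus works for every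
  \<open>K\<close> in the family at once (\<open>openin_Inter_G\<close>). In other words, on the complement of \<open>F\<close> the sets \<open>G K F\<close> are up-sets of the preorder
  ``\<open>y \<in> G {x} F\<close>'' and \<open>G {x} F\<close> is the smallest up-set containing \<open>x\<close>, as in an Alexandrov topology.
\<close>

lemma
  assumes "strong_monotone_normality_operator X G" and "disjoint_closed_pair X H K"
  shows openin_G: "openin X (G H K)"
    and subset_G: "H \<subseteq> G H K"
    and G_avoids: "G H K \<inter> K = {}"
    and G_disjoint_swap: "G H K \<inter> G K H = {}"
    and G_absorbs: "\<And>H'. closedin X H' \<Longrightarrow> H' \<subseteq> G H K \<Longrightarrow> G H' K \<subseteq> G H K"
proof -
  note G = assms(1)[unfolded strong_monotone_normality_operator_def]
  show "openin X (G H K)" using G assms(2) by simp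
  have *: "H \<subseteq> G H K \<and> G H K \<subseteq> X closure_of (G H K) \<and> X closure_of (G H K) \<subseteq> topspace X - K"
    using G assms(2) by simp
  then show "H \<subseteq> G H K" by simp
  from * show "G H K \<inter> K = {}" by blast
  show "G H K \<inter> G K H = {}" using G assms(2) by simp
  show "\<And>H'. closedin X H' \<Longrightarrow> H' \<subseteq> G H K \<Longrightarrow> G H' K \<subseteq> G H K" using G assms(2) by simp
qed

text \<open>An intersection of open sets is open as soon as each of its points has one neighborhood that
  works for all of them simultaneously.\<close>

lemma openin_Inter_G:
  assumes "t1_space X" and G: "strong_monotone_normality_operator X G"
    and \<K>: "\<And>K. K \<in> \<K> \<Longrightarrow> disjoint_closed_pair X K F" and "\<K> \<noteq> {}"
  shows "openin X (\<Inter>K\<in>\<K>. G K F)"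
proof (subst openin_subopen, intro ballI)
  fix x assume x: "x \<in> (\<Inter>K\<in>\<K>. G K F)"
  obtain K where "K \<in> \<K>" using \<open>\<K> \<noteq> {}\<close> by blast
  with \<K> x have K: "disjoint_closed_pair X K F" "x \<in> G K F" by auto
  then have "x \<in> topspace X - F"
    using openin_subset[OF openin_G[OF G K(1)]] G_avoids[OF G K(1)] by blast
  with \<open>t1_space X\<close> K have x_F: "disjoint_closed_pair X {x} F"
    by (auto simp: disjoint_closed_pair_def t1_space_closedin_singleton)
  have "openin X (G {x} F)" "x \<in> G {x} F"
    using openin_G[OF G x_F] subset_G[OF G x_F] by auto
  moreover have "G {x} F \<subseteq> G L F" if "L \<in> \<K>" for L
  proof -
    have "disjoint_closed_pair X L F" "closedin X {x}" "{x} \<subseteq> G L F"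
      using that \<K> x x_F by (auto simp: disjoint_closed_pair_def)
    then show ?thesis by (rule G_absorbs[OF G])
  qed
  ultimately show "\<exists>T. openin X T \<and> x \<in> T \<and> T \<subseteq> (\<Inter>K\<in>\<K>. G K F)" by blast
qed

lemma closure_preserving_closedI:
  assumes "\<And>P. P \<in> \<P> \<Longrightarrow> closedin X P"
    and "\<And>\<P>'. \<P>' \<subseteq> \<P> \<Longrightarrow> closedin X (\<Union>\<P>')"
  shows "closure_preserving X \<P>"
  unfolding closure_preserving_def
proof (intro allI impI)
  fix \<P>' assume "\<P>' \<subseteq> \<P>"
  then have "X closure_of P = P" if "P \<in> \<P>'" for P
    using assms(1) that by (simp add: closure_of_closedin subset_iff)
  moreover have "X closure_of (\<Union>\<P>') = \<Union>\<P>'"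
    using assms(2) \<open>\<P>' \<subseteq> \<P>\<close> by (simp add: closure_of_closedin)
  ultimately show "X closure_of (\<Union>\<P>') = (\<Union>P\<in>\<P>'. X closure_of P)" by simp
qed

lemma closure_preserving_complements_G:
  assumes "t1_space X" and G: "strong_monotone_normality_operator X G"
  shows "closure_preserving X {topspace X - G K F |K. disjoint_closed_pair X K F}"
proof -
  let ?A = "{topspace X - G K F |K. disjoint_closed_pair X K F}"
  have unions: "closedin X (\<Union>\<P>)" if "\<P> \<subseteq> ?A" for \<P>
  proof (cases "\<P> = {}")
    case False
    define \<K> where "\<K> = {K. disjoint_closed_pair X K F \<and> topspace X - G K F \<in> \<P>}"
    have \<P>: "\<P> = (\<lambda>K. topspace X - G K F) ` \<K>"
      using that by (auto simp: \<K>_def)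
    with False have "\<K> \<noteq> {}" by blast
    then have "openin X (\<Inter>K\<in>\<K>. G K F)"
      by (intro openin_Inter_G assms) (auto simp: \<K>_def)
    moreover have "\<Union>\<P> = topspace X - (\<Inter>K\<in>\<K>. G K F)"
      using \<P> by auto
    ultimately show ?thesis by (simp add: openin_closedin_eq closedin_diff)
  qed simp
  show ?thesis
  proof (rule closure_preserving_closedI)
    show "closedin X P" if "P \<in> ?A" for P
      using unions[of "{P}"] that by simp
  qed (rule unions)
qed

lemma quasi_base_at_complements_G:
  assumes "t1_space X" and G: "strong_monotone_normality_operator X G" and F: "closedin X F"
  shows "quasi_base_at X F {topspace X - G K F |K. disjoint_closed_pair X K F}"
    (is "quasi_base_at X F ?A")
proof -
  have F_top: "F \<subseteq> topspace X"
    using F by (rule closedin_subset)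
  have base: "\<exists>V\<in>?A. F \<subseteq> X interior_of V \<and> X interior_of V \<subseteq> V \<and> V \<subseteq> U"
    if U: "neighborhood_of_set X F U" for U
  proof -
    let ?K = "topspace X - X interior_of U"
    have K_F: "disjoint_closed_pair X ?K F" and F_K: "disjoint_closed_pair X F ?K"
      using F U by (auto simp: disjoint_closed_pair_def neighborhood_of_set_def)
    have "openin X (G F ?K)" "F \<subseteq> G F ?K" "G F ?K \<inter> G ?K F = {}"
      using openin_G[OF G F_K] subset_G[OF G F_K] G_disjoint_swap[OF G F_K] by auto
    moreover from this have "G F ?K \<subseteq> topspace X - G ?K F"
      using openin_subset[of X "G F ?K"] by blast
    ultimately have "F \<subseteq> X interior_of (topspace X - G ?K F)"
      using interior_of_maximal[of "G F ?K" "topspace X - G ?K F" X] by blast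
    moreover have "topspace X - G ?K F \<subseteq> U"
      using subset_G[OF G K_F] interior_of_subset[of X U] by blast
    ultimately show ?thesis
      using K_F interior_of_subset[of X "topspace X - G ?K F"] by blast
  qed
  have "F = \<Inter>?A"
  proof
    show "F \<subseteq> \<Inter>?A" using G_avoids[OF G] F_top by blast
    show "\<Inter>?A \<subseteq> F"
    proof
      fix x assume x: "x \<in> \<Inter>?A"
      \<comment> \<open>The empty \<open>K\<close> guarantees that the family is inhabited, hence that \<open>x\<close> is a point of the space.\<close>
      have "disjoint_closed_pair X {} F" using F by (simp add: disjoint_closed_pair_def)
      with x have "x \<in> topspace X" by blast
      show "x \<in> F"
      proof (rule ccontr)
        assume "x \<notin> F"
        with \<open>x \<in> topspace X\<close> F \<open>t1_space X\<close> have x_F: "disjoint_closed_pair X {x} F"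
          by (auto simp: disjoint_closed_pair_def t1_space_closedin_singleton)
        with x subset_G[OF G x_F] show False by blast
      qed
    qed
  qed
  moreover have "\<forall>V\<in>?A. V \<subseteq> topspace X" by blast
  ultimately show ?thesis unfolding quasi_base_at_def using base F_top by simp
qed

theorem theorem4p3:
  fixes X :: "'a topology"
  assumes "t1_space X" and "regular_space X"
    and "strongly_monotonically_normal X"
  shows "s_m2_space X"
proof -
  obtain G where "strong_monotone_normality_operator X G"
    using assms(3) unfolding strongly_monotonically_normal_def by blast
  with \<open>t1_space X\<close> show ?thesis
    unfolding s_m2_space_def s_m2_at_def
    using quasi_base_at_complements_G closure_preserving_complements_G by blast
qed

end
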